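(* There exist $f,g\in\mathrm{AIET}([0,1))$ such that the group $\langle f,g\rangle$ generated by $f$ and $g$ under composition is a free group of rank $2$.
   Context: An affine interval exchange transformation (AIET) on $[0,1)$ is a bijection from $[0,1)$ onto itself which is everywhere continuous on the right, continuous except at a finite number of points, differentiable except on a finite set, and whose derivative is constant on every interval where it is defined. $\mathrm{AIET}([0,1))$ denotes the set of all AIETs on $[0,1)$. *)

theory Defs
  imports "HOL-Analysis.Analysis" "HOL-Algebra.Bij" "HOL-Algebra.Elementary_Groups"
begin

text \<open>
  The maps live in \<^term>\<open>Bij {0..<1}\<close>, the bijections of \<open>[0,1)\<close> that are \<^term>\<open>undefined\<close>
  outside it.  Continuity and differentiability are therefore taken within \<open>[0,1)\<close>; this only
  matters at the endpoint \<open>0\<close>, where they become one-sided.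
\<close>

definition AIET :: "(real \<Rightarrow> real) set" where
  "AIET = {f \<in> Bij {0..<1}.
     (\<forall>x\<in>{0..<1}. continuous (at_right x) f) \<and>
     finite {x \<in> {0..<1}. \<not> continuous (at x within {0..<1}) f} \<and>
     finite {x \<in> {0..<1}. \<not> f differentiable (at x within {0..<1})} \<and>
     (\<forall>I. is_interval I \<and> I \<subseteq> {0..<1} \<and> (\<forall>x\<in>I. f differentiable (at x within {0..<1})) \<longrightarrow>
        (\<exists>c. \<forall>x\<in>I. (f has_real_derivative c) (at x within {0..<1})))}"

text \<open>
  The free group on a set \<open>X\<close>: reduced words in the letters \<open>x = (True, x)\<close> and
  \<open>x\<inverse> = (False, x)\<close> for \<open>x \<in> X\<close>, multiplied by concatenation followed by free reduction.
\<close>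

type_synonym 'a letter = "bool \<times> 'a"

definition inv_letter :: "'a letter \<Rightarrow> 'a letter" where
  "inv_letter a = (\<not> fst a, snd a)"

definition reduced_word :: "'a letter list \<Rightarrow> bool" where
  "reduced_word w \<longleftrightarrow> successively (\<lambda>a b. b \<noteq> inv_letter a) w"

fun cons_reduce :: "'a letter \<Rightarrow> 'a letter list \<Rightarrow> 'a letter list" where
  "cons_reduce a [] = [a]"
| "cons_reduce a (b # w) = (if b = inv_letter a then w else a # b # w)"

definition free_group :: "'a set \<Rightarrow> 'a letter list monoid" where
  "free_group X =
     \<lparr>carrier = {w. reduced_word w \<and> snd ` set w \<subseteq> X},
      mult = (\<lambda>u v. foldr cons_reduce u v),
      one = []\<rparr>"

definition is_free_group_of_rank :: "('g, 'm) monoid_scheme \<Rightarrow> nat \<Rightarrow> bool" where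
  "is_free_group_of_rank G n \<longleftrightarrow> G \<cong> free_group {..<n}"

lemma inv_letter_inv_letter [simp]: "inv_letter (inv_letter a) = a"
  by (simp add: inv_letter_def)

lemma inv_letter_neq [simp]: "inv_letter a \<noteq> a" "a \<noteq> inv_letter a"
  by (auto simp: inv_letter_def prod_eq_iff)

lemma snd_inv_letter [simp]: "snd (inv_letter a) = snd a"
  by (simp add: inv_letter_def)

lemma reduced_Nil [simp]: "reduced_word []"
  by (simp add: reduced_word_def)

lemma reduced_Cons:
  "reduced_word (a # w) \<longleftrightarrow> reduced_word w \<and> (w \<noteq> [] \<longrightarrow> hd w \<noteq> inv_letter a)"
  by (cases w) (auto simp: reduced_word_def)

lemma reduced_cons_reduce: "reduced_word w \<Longrightarrow> reduced_word (cons_reduce a w)"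
  by (cases w) (auto simp: reduced_Cons)

lemma letters_cons_reduce: "snd ` set (cons_reduce a w) \<subseteq> insert (snd a) (snd ` set w)"
  by (cases w) auto

lemma cons_reduce_inv:
  assumes "reduced_word w"
  shows "cons_reduce a (cons_reduce (inv_letter a) w) = w"
proof (cases w)
  case (Cons b v)
  with assms show ?thesis by (cases v) (auto simp: reduced_Cons)
qed auto

lemma reduced_foldr: "reduced_word v \<Longrightarrow> reduced_word (foldr cons_reduce u v)"
  by (induction u) (auto intro: reduced_cons_reduce)

lemma letters_foldr: "snd ` set (foldr cons_reduce u v) \<subseteq> snd ` set u \<union> snd ` set v"
proof (induction u)
  case (Cons a u)
  then show ?case
    using letters_cons_reduce[of a "foldr cons_reduce u v"] by (simp, blast)
qed simp

lemma foldr_cons_reduce: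
  assumes "reduced_word w"
  shows "foldr cons_reduce (cons_reduce a v) w = cons_reduce a (foldr cons_reduce v w)"
proof (cases v)
  case (Cons b v')
  have "cons_reduce a (cons_reduce (inv_letter a) (foldr cons_reduce v' w)) = foldr cons_reduce v' w"
    by (intro cons_reduce_inv reduced_foldr assms)
  with Cons show ?thesis by simp
qed simp

lemma foldr_assoc:
  assumes "reduced_word w"
  shows "foldr cons_reduce (foldr cons_reduce u v) w = foldr cons_reduce u (foldr cons_reduce v w)"
  by (induction u) (simp_all add: foldr_cons_reduce assms)

lemma foldr_reduced_Nil: "reduced_word w \<Longrightarrow> foldr cons_reduce w [] = w"
proof (induction w)
  case (Cons a w)
  then show ?case by (cases w) (auto simp: reduced_Cons)
qed simp

lemma foldr_inverse_word:
  "reduced_word v \<Longrightarrow> foldr cons_reduce (rev (map inv_letter w)) (foldr cons_reduce w v) = v"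
proof (induction w arbitrary: v)
  case (Cons a w)
  have "cons_reduce (inv_letter a) (cons_reduce a (foldr cons_reduce w v)) = foldr cons_reduce w v"
    using cons_reduce_inv[of "foldr cons_reduce w v" "inv_letter a"] Cons.prems
    by (simp add: reduced_foldr)
  with Cons show ?case by simp
qed simp

lemma group_free_group: "group (free_group X)"
proof (rule groupI)
  fix u v assume "u \<in> carrier (free_group X)" "v \<in> carrier (free_group X)"
  then show "u \<otimes>\<^bsub>free_group X\<^esub> v \<in> carrier (free_group X)"
    using reduced_foldr[of v u] letters_foldr[of u v] unfolding free_group_def by simp blast
next
  fix u v w
  assume "w \<in> carrier (free_group X)"
  then show "u \<otimes>\<^bsub>free_group X\<^esub> v \<otimes>\<^bsub>free_group X\<^esub> w =
             u \<otimes>\<^bsub>free_group X\<^esub> (v \<otimes>\<^bsub>free_group X\<^esub> w)"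
    by (simp add: free_group_def foldr_assoc)
next
  fix w assume w: "w \<in> carrier (free_group X)"
  let ?w' = "foldr cons_reduce (rev (map inv_letter w)) []"
  have "snd ` set ?w' \<subseteq> snd ` set w"
    using letters_foldr[of "rev (map inv_letter w)" "[]"] by (simp add: image_image)
  also have "\<dots> \<subseteq> X"
    using w by (simp add: free_group_def)
  finally have "?w' \<in> carrier (free_group X)"
    by (simp add: free_group_def reduced_foldr)
  moreover have "?w' \<otimes>\<^bsub>free_group X\<^esub> w = \<one>\<^bsub>free_group X\<^esub>"
    using w foldr_inverse_word[of "[]" w]
    by (simp add: free_group_def foldr_assoc foldr_reduced_Nil)
  ultimately show "\<exists>v\<in>carrier (free_group X). v \<otimes>\<^bsub>free_group X\<^esub> w = \<one>\<^bsub>free_group X\<^esub>"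
    by blast
qed (auto simp: free_group_def)

end

theory Submission
  imports Defs
begin

text \<open>
  Ping-pong.  Split \<open>[0,1)\<close> into five intervals of length \<open>1/5\<close>, the attracting sets of
  \<open>f\<inverse>\<close>, \<open>f\<close>, \<open>g\<close> and \<open>g\<inverse>\<close> with a base interval in the middle.  An AIET may be discontinuous,
  so \<open>f\<close> can be chosen to send the complement of the first interval affinely onto the second,
  and the first interval, cut in two, onto the complement of the second; likewise \<open>g\<close> at the
  other end of \<open>[0,1)\<close>.  A nonempty reduced word then moves the midpoint into the attracting set
  of its first letter.
\<close>

section \<open>Evaluation of words in a group\<close>

definition letter_val :: "('g, 'm) monoid_scheme \<Rightarrow> ('a \<Rightarrow> 'g) \<Rightarrow> 'a letter \<Rightarrow> 'g" where
  "letter_val G h a = (if fst a then h (snd a) else inv\<^bsub>G\<^esub> (h (snd a)))"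

text \<open>The map that the universal property of the free group attaches to \<open>h\<close>. It
  is defined on all words, reduced or not, so inductions over words need not track
  reducedness.\<close>

definition word_val :: "('g, 'm) monoid_scheme \<Rightarrow> ('a \<Rightarrow> 'g) \<Rightarrow> 'a letter list \<Rightarrow> 'g" where
  "word_val G h w = foldr (\<lambda>a u. letter_val G h a \<otimes>\<^bsub>G\<^esub> u) w \<one>\<^bsub>G\<^esub>"

lemma word_val_Nil [simp]: "word_val G h [] = \<one>\<^bsub>G\<^esub>"
  by (simp add: word_val_def)

lemma word_val_Cons [simp]: "word_val G h (a # w) = letter_val G h a \<otimes>\<^bsub>G\<^esub> word_val G h w"
  by (simp add: word_val_def)

context group
begin

lemma letter_val_closed:
  "h \<in> I \<rightarrow> carrier G \<Longrightarrow> snd a \<in> I \<Longrightarrow> letter_val G h a \<in> carrier G"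
  by (auto simp: letter_val_def)

lemma word_val_closed:
  "h \<in> I \<rightarrow> carrier G \<Longrightarrow> snd ` set w \<subseteq> I \<Longrightarrow> word_val G h w \<in> carrier G"
  by (induction w) (auto intro: letter_val_closed)

lemma letter_val_mult_inv_letter:
  assumes "h \<in> I \<rightarrow> carrier G" "snd a \<in> I"
  shows "letter_val G h a \<otimes> letter_val G h (inv_letter a) = \<one>"
  using funcset_mem[OF assms] by (simp add: letter_val_def inv_letter_def)

text \<open>Only the cancelling case needs an argument: dropping adjacent \<open>a\<close> and
  \<open>inv_letter a\<close> leaves the value unchanged, since their values are mutually
  inverse.\<close>

lemma word_val_cons_reduce:
  assumes h: "h \<in> I \<rightarrow> carrier G" and "snd a \<in> I" "snd ` set w \<subseteq> I"
  shows "word_val G h (cons_reduce a w) = letter_val G h a \<otimes> word_val G h w"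
proof (cases w)
  case (Cons b v)
  show ?thesis
  proof (cases "b = inv_letter a")
    case True
    have "letter_val G h a \<otimes> (letter_val G h b \<otimes> word_val G h v) = word_val G h v"
      using assms Cons letter_val_mult_inv_letter[OF h, of a] True
      by (simp add: m_assoc[symmetric] letter_val_closed[OF h] word_val_closed[OF h])
    then show ?thesis using Cons True by simp
  next
    case False
    then show ?thesis using Cons by simp
  qed
qed simp

lemma word_val_foldr_cons_reduce:
  assumes h: "h \<in> I \<rightarrow> carrier G" and "snd ` set u \<subseteq> I" and v: "snd ` set v \<subseteq> I"
  shows "word_val G h (foldr cons_reduce u v) = word_val G h u \<otimes> word_val G h v"
  using assms(2)
proof (induction u)
  case Nil
  show ?case using word_val_closed[OF h v] by simp
next
  case (Cons a u)
  have "snd a \<in> I" and u: "snd ` set u \<subseteq> I" using Cons.prems by auto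
  moreover have "snd ` set (foldr cons_reduce u v) \<subseteq> I"
    using u v by (intro order_trans[OF letters_foldr]) simp
  ultimately show ?case
    using Cons.IH[OF u] letter_val_closed[OF h, of a] word_val_closed[OF h u] word_val_closed[OF h v]
    by (simp add: word_val_cons_reduce[OF h] m_assoc)
qed

lemma word_val_hom:
  assumes "h \<in> I \<rightarrow> carrier G"
  shows "word_val G h \<in> hom (free_group I) G"
  using assms by (auto simp: hom_def free_group_def word_val_closed word_val_foldr_cons_reduce)

text \<open>Each letter value is a generator or the inverse of one, and conversely the image is a
  subgroup that contains every \<open>h i\<close> as the value of a one-letter word.\<close>

lemma word_val_image:
  assumes h: "h \<in> I \<rightarrow> carrier G"
  shows "word_val G h ` carrier (free_group I) = generate G (h ` I)"
proof
  have hI: "h ` I \<subseteq> carrier G" using h by auto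
  have "word_val G h w \<in> generate G (h ` I)" if "snd ` set w \<subseteq> I" for w
    using that
  proof (induction w)
    case (Cons a w)
    then have "letter_val G h a \<in> generate G (h ` I)"
      by (simp add: letter_val_def generate.incl generate.inv)
    then show ?case using Cons by (simp add: generate.eng)
  qed (simp add: generate.one)
  then show "word_val G h ` carrier (free_group I) \<subseteq> generate G (h ` I)"
    by (auto simp: free_group_def)
  interpret wv: group_hom "free_group I" G "word_val G h"
    using group_free_group word_val_hom[OF h] group_axioms
    by (auto intro!: group_hom.intro group_hom_axioms.intro)
  have "h i \<in> word_val G h ` carrier (free_group I)" if "i \<in> I" for i
  proof (rule image_eqI[of _ _ "[(True, i)]"])
    show "h i = word_val G h [(True, i)]"
      using funcset_mem[OF h that] by (simp add: letter_val_def)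
  qed (use that in \<open>simp add: free_group_def reduced_Cons\<close>)
  then show "generate G (h ` I) \<subseteq> word_val G h ` carrier (free_group I)"
    by (intro generate_subgroup_incl wv.img_is_subgroup) auto
qed

lemma free_group_iso_subgroup_generated:
  assumes h: "h \<in> I \<rightarrow> carrier G"
    and free: "\<And>w. reduced_word w \<Longrightarrow> snd ` set w \<subseteq> I \<Longrightarrow> word_val G h w = \<one> \<Longrightarrow> w = []"
  shows "subgroup_generated G (h ` I) \<cong> free_group I"
proof -
  interpret wv: group_hom "free_group I" G "word_val G h"
    using group_free_group word_val_hom[OF h] group_axioms
    by (auto intro!: group_hom.intro group_hom_axioms.intro)
  have "inj_on (word_val G h) (carrier (free_group I))"
    using free by (auto simp: wv.inj_on_one_iff) (auto simp: free_group_def)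
  \<comment> \<open>\<open>subgroup_generated\<close> first intersects the generators with the
    carrier; here they already lie in it.\<close>
  moreover have "carrier (subgroup_generated G (h ` I)) = generate G (h ` I)"
    using h by (auto simp: carrier_subgroup_generated Int_absorb1 image_subset_iff_funcset)
  ultimately have "word_val G h \<in> iso (free_group I) (subgroup_generated G (h ` I))"
    using word_val_hom[OF h] word_val_image[OF h]
    by (auto simp: iso_def bij_betw_def hom_def)
  then show ?thesis
    using group.iso_sym[OF group_free_group] by (auto simp: is_iso_def)
qed

end

section \<open>Ping-pong\<close>

lemma carrier_BijGroup: "carrier (BijGroup S) = Bij S"
  by (simp add: BijGroup_def)

lemma mult_BijGroup:
  "f \<in> Bij S \<Longrightarrow> g \<in> Bij S \<Longrightarrow> f \<otimes>\<^bsub>BijGroup S\<^esub> g = compose S f g"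
  by (simp add: BijGroup_def)

lemma one_BijGroup: "\<one>\<^bsub>BijGroup S\<^esub> = (\<lambda>x\<in>S. x)"
  by (simp add: BijGroup_def)

text \<open>One inclusion serves both signs. If \<open>h i\<close> maps the complement of
  \<open>X (False, i)\<close> into \<open>X (True, i)\<close>, then a point outside
  \<open>X (True, i)\<close> has its preimage in \<open>X (False, i)\<close>.\<close>

lemma ping_pong_letter:
  assumes h: "h i \<in> Bij S" and "h i ` (S - X (False, i)) \<subseteq> X (True, i)"
    and a: "snd a = i" and x: "x \<in> S" "x \<notin> X (inv_letter a)"
  shows "letter_val (BijGroup S) h a x \<in> X a \<inter> S"
proof -
  have bij: "bij_betw (h i) S S" using h by (simp add: Bij_def)
  show ?thesis
  proof (cases "fst a")
    case True
    then have "a = (True, i)" using a by (simp add: prod_eq_iff)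
    then show ?thesis
      using assms bij_betwE[OF bij] by (auto simp: letter_val_def inv_letter_def)
  next
    case False
    then have a_eq: "a = (False, i)" using a by (simp add: prod_eq_iff)
    let ?y = "inv_into S (h i) x"
    have "?y \<in> S" "h i ?y = x"
      using bij x by (auto simp: bij_betw_def inv_into_into f_inv_into_f)
    then show ?thesis
      using assms a_eq by (auto simp: letter_val_def inv_letter_def inv_BijGroup)
  qed
qed

text \<open>The leftmost letter acts last. By induction the tail has moved \<open>p\<close> into the
  set of its own first letter; reducedness and disjointness keep that set away from
  \<open>X (inv_letter a)\<close>, so \<open>a\<close> moves the point into \<open>X a\<close>. For
  an empty tail, \<open>p\<close> itself avoids all the sets.\<close>

lemma ping_pong_word:
  assumes h: "\<And>i. i \<in> I \<Longrightarrow> h i \<in> Bij S"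
    and pp: "\<And>i. i \<in> I \<Longrightarrow> h i ` (S - X (False, i)) \<subseteq> X (True, i)"
    and disj: "\<And>a b. snd a \<in> I \<Longrightarrow> snd b \<in> I \<Longrightarrow> a \<noteq> b \<Longrightarrow> X a \<inter> X b = {}"
    and p: "p \<in> S" "\<And>a. snd a \<in> I \<Longrightarrow> p \<notin> X a"
    and w: "reduced_word w" "snd ` set w \<subseteq> I" "w \<noteq> []"
  shows "word_val (BijGroup S) h w p \<in> X (hd w) \<inter> S"
  using w
proof (induction w)
  case (Cons a w)
  interpret group "BijGroup S" by (rule group_BijGroup)
  have hI: "h \<in> I \<rightarrow> carrier (BijGroup S)" using h by (simp add: carrier_BijGroup)
  let ?x = "word_val (BijGroup S) h w p"
  have "letter_val (BijGroup S) h a \<in> Bij S" "word_val (BijGroup S) h w \<in> Bij S"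
    using letter_val_closed[OF hI, of a] word_val_closed[OF hI, of w] Cons.prems
    by (simp_all add: carrier_BijGroup)
  then have step: "word_val (BijGroup S) h (a # w) p = letter_val (BijGroup S) h a ?x"
    using p(1) by (simp add: mult_BijGroup compose_def)
  have "?x \<in> S \<and> ?x \<notin> X (inv_letter a)"
  proof (cases "w = []")
    case True
    then have "?x = p" using p(1) by (simp add: one_BijGroup)
    then show ?thesis using p(1) p(2)[of "inv_letter a"] Cons.prems by simp
  next
    case False
    have "?x \<in> X (hd w) \<inter> S"
      using False Cons.prems by (intro Cons.IH) (simp_all add: reduced_Cons)
    moreover have "hd w \<noteq> inv_letter a" "snd (hd w) \<in> I" "snd (inv_letter a) \<in> I"
      using False Cons.prems hd_in_set[of w] by (auto simp: reduced_Cons)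
    ultimately show ?thesis using disj by blast
  qed
  moreover have "snd a \<in> I" using Cons.prems by simp
  ultimately have "letter_val (BijGroup S) h a ?x \<in> X a \<inter> S"
    by (intro ping_pong_letter[OF h pp]) simp_all
  then show ?case by (simp add: step del: word_val_Cons)
qed simp

theorem ping_pong:
  assumes "\<And>i. i \<in> I \<Longrightarrow> h i \<in> Bij S"
    and "\<And>i. i \<in> I \<Longrightarrow> h i ` (S - X (False, i)) \<subseteq> X (True, i)"
    and "\<And>a b. snd a \<in> I \<Longrightarrow> snd b \<in> I \<Longrightarrow> a \<noteq> b \<Longrightarrow> X a \<inter> X b = {}"
    and p: "p \<in> S" "\<And>a. snd a \<in> I \<Longrightarrow> p \<notin> X a"
  shows "subgroup_generated (BijGroup S) (h ` I) \<cong> free_group I"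
proof (rule group.free_group_iso_subgroup_generated[OF group_BijGroup])
  show "h \<in> I \<rightarrow> carrier (BijGroup S)" using assms(1) by (simp add: carrier_BijGroup)
next
  fix w assume w: "reduced_word w" "snd ` set w \<subseteq> I" "word_val (BijGroup S) h w = \<one>\<^bsub>BijGroup S\<^esub>"
  show "w = []"
  proof (rule ccontr)
    assume "w \<noteq> []"
    then have "snd (hd w) \<in> I" using w(2) hd_in_set by blast
    moreover have "word_val (BijGroup S) h w p \<in> X (hd w) \<inter> S"
      using assms w(1,2) \<open>w \<noteq> []\<close> by (rule ping_pong_word)
    ultimately show False using w(3) p by (simp add: one_BijGroup)
  qed
qed

section \<open>Affine interval exchanges with three pieces\<close>

text \<open>The point \<open>a\<close> may lie outside \<open>T\<close>, so the affine formula is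
  not given there. Continuity forces \<open>f a = c * a + d\<close>, and then the difference
  quotient along \<open>T\<close> is constantly \<open>c\<close>.\<close>

lemma derivative_eq_slope:
  fixes f :: "real \<Rightarrow> real"
  assumes D: "(f has_real_derivative D) (at a within S)" and "T \<subseteq> S" "a islimpt T"
    and T: "\<And>x. x \<in> T \<Longrightarrow> f x = c * x + d"
  shows "D = c"
proof -
  have nt: "at a within T \<noteq> bot"
    using \<open>a islimpt T\<close> by (simp add: trivial_limit_within)
  have DT: "(f has_real_derivative D) (at a within T)"
    using D \<open>T \<subseteq> S\<close> by (rule DERIV_subset)
  have ev: "\<forall>\<^sub>F x in at a within T. x \<in> T \<and> x \<noteq> a"
    by (simp add: eventually_at_filter)
  have "((\<lambda>x. c * x + d) \<longlongrightarrow> c * a + d) (at a within T)"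
    by (intro tendsto_intros)
  moreover have "((\<lambda>x. c * x + d) \<longlongrightarrow> f a) (at a within T)"
    using DERIV_continuous[OF DT] unfolding continuous_within
    by (rule Lim_transform_eventually) (use ev T in \<open>auto elim: eventually_mono\<close>)
  ultimately have fa: "f a = c * a + d"
    using tendsto_unique[OF nt] by blast
  have "((\<lambda>x. (f x - f a) / (x - a)) \<longlongrightarrow> c) (at a within T)"
  proof (rule tendsto_eventually)
    show "\<forall>\<^sub>F x in at a within T. (f x - f a) / (x - a) = c"
      using ev by (rule eventually_mono) (auto simp: T fa field_simps)
  qed
  moreover have "((\<lambda>x. (f x - f a) / (x - a)) \<longlongrightarrow> D) (at a within T)"
    using DT by (simp add: has_field_derivative_iff)
  ultimately show ?thesis
    using tendsto_unique[OF nt] by blast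
qed

text \<open>A derivative at \<open>a\<close> would equal both one-sided slopes. This keeps intervals
  of differentiability from crossing a break.\<close>

lemma not_differentiable_at_break:
  fixes f :: "real \<Rightarrow> real"
  assumes "l < a" "a < r" "{l<..<r} \<subseteq> S"
    and "\<And>x. x \<in> {l<..<a} \<Longrightarrow> f x = c * x + d" "\<And>x. x \<in> {a<..<r} \<Longrightarrow> f x = c' * x + d'"
    and "c \<noteq> c'"
  shows "\<not> f differentiable (at a within S)"
proof
  assume "f differentiable (at a within S)"
  then obtain D where D: "(f has_real_derivative D) (at a within S)"
    by (auto simp: real_differentiable_def)
  have "D = c"
    using assms by (intro derivative_eq_slope[OF D, of "{l<..<a}" c d]) (auto simp: islimpt_greaterThanLessThan2)
  moreover have "D = c'"
    using assms by (intro derivative_eq_slope[OF D, of "{a<..<r}" c' d']) (auto simp: islimpt_greaterThanLessThan1)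
  ultimately show False using \<open>c \<noteq> c'\<close> by simp
qed

text \<open>Inside the piece this is local. At its left end it holds only if \<open>S\<close> has no
  points further left, which covers the endpoint 0 and right-sided derivatives at breaks.\<close>

lemma affine_piece_has_derivative:
  fixes f :: "real \<Rightarrow> real"
  assumes f: "\<And>x. x \<in> {l..<r} \<Longrightarrow> f x = c * x + d"
    and x: "x \<in> S" "x \<in> {l..<r}" and l: "x \<noteq> l \<or> S \<subseteq> {l..}"
  shows "(f has_real_derivative c) (at x within S)"
proof -
  define e where "e = (if x = l then r - x else min (x - l) (r - x))"
  show ?thesis
  proof (rule has_field_derivative_transform_within[of "\<lambda>x. c * x + d" _ _ _ e])
    show "((\<lambda>x. c * x + d) has_real_derivative c) (at x within S)"
      by (auto intro!: derivative_eq_intros)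
    show "0 < e" using x by (auto simp: e_def)
    fix y assume y: "y \<in> S" "dist y x < e"
    then have "y \<in> {l..<r}"
      using x l by (auto simp: e_def dist_real_def split: if_splits)
    then show "c * y + d = f y" by (simp add: f)
  qed fact
qed

lemma three_piece_AIET:
  assumes bij: "f \<in> Bij {0..<1}" and ab: "0 < a" "a < b" "b < 1"
    and f1: "\<And>x. x \<in> {0..<a} \<Longrightarrow> f x = c1 * x + d1"
    and f2: "\<And>x. x \<in> {a..<b} \<Longrightarrow> f x = c2 * x + d2"
    and f3: "\<And>x. x \<in> {b..<1} \<Longrightarrow> f x = c3 * x + d3"
    and c: "c1 \<noteq> c2" "c2 \<noteq> c3"
  shows "f \<in> AIET"
proof -
  let ?S = "{0..<1::real}"
  have pieces: "x \<in> {0..<a} \<or> x \<in> {a..<b} \<or> x \<in> {b..<1}" if "x \<in> ?S" for x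
    using that by auto
  have D1: "(f has_real_derivative c1) (at x within ?S)" if "x \<in> {0..<a}" for x
    using that ab by (intro affine_piece_has_derivative[OF f1]) auto
  have D2: "(f has_real_derivative c2) (at x within ?S)" if "x \<in> {a<..<b}" for x
    using that ab by (intro affine_piece_has_derivative[OF f2]) auto
  have D3: "(f has_real_derivative c3) (at x within ?S)" if "x \<in> {b<..<1}" for x
    using that ab by (intro affine_piece_has_derivative[OF f3]) auto
  have diff: "f differentiable (at x within ?S)" if "x \<in> ?S" "x \<noteq> a" "x \<noteq> b" for x
  proof -
    have "x \<in> {0..<a} \<or> x \<in> {a<..<b} \<or> x \<in> {b<..<1}" using that by auto
    then show ?thesis
      using D1 D2 D3 by (auto simp: real_differentiable_def)
  qed
  have not_diff_a: "\<not> f differentiable (at a within ?S)"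
    using ab c by (intro not_differentiable_at_break[of 0 a b _ f c1 d1 c2 d2] f1 f2) auto
  have not_diff_b: "\<not> f differentiable (at b within ?S)"
    using ab c by (intro not_differentiable_at_break[of a b 1 _ f c2 d2 c3 d3] f2 f3) auto
  have "continuous (at_right x) f" if "x \<in> ?S" for x
  proof -
    \<comment> \<open>Within \<open>{x..}\<close> the left end of a piece is as good as an interior
      point, so right continuity holds at the breaks too.\<close>
    have "\<exists>D. (f has_real_derivative D) (at x within {x..})"
      using pieces[OF that]
    proof (elim disjE)
      assume "x \<in> {0..<a}"
      then have "(f has_real_derivative c1) (at x within {x..})"
        by (intro affine_piece_has_derivative[OF f1]) auto
      then show ?thesis ..
    next
      assume "x \<in> {a..<b}"
      then have "(f has_real_derivative c2) (at x within {x..})"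
        by (intro affine_piece_has_derivative[OF f2]) auto
      then show ?thesis ..
    next
      assume "x \<in> {b..<1}"
      then have "(f has_real_derivative c3) (at x within {x..})"
        by (intro affine_piece_has_derivative[OF f3]) auto
      then show ?thesis ..
    qed
    then have "continuous (at x within {x..}) f"
      using DERIV_continuous by blast
    then show ?thesis
      by (rule continuous_within_subset) auto
  qed
  moreover have "finite {x \<in> ?S. \<not> f differentiable (at x within ?S)}"
    by (rule finite_subset[of _ "{a, b}"]) (use diff in auto)
  moreover have "finite {x \<in> ?S. \<not> continuous (at x within ?S) f}"
    by (rule finite_subset[of _ "{a, b}"]) (use diff in \<open>auto dest: differentiable_imp_continuous_within\<close>)
  moreover have "\<exists>k. \<forall>x\<in>I. (f has_real_derivative k) (at x within ?S)"
    if I: "is_interval I" "I \<subseteq> ?S" "\<forall>x\<in>I. f differentiable (at x within ?S)" for I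
  proof -
    have "a \<notin> I" "b \<notin> I" using I(3) not_diff_a not_diff_b by auto
    \<comment> \<open>An interval that misses \<open>a\<close> and \<open>b\<close> lies on one side
      of each.\<close>
    then have sep: "x < a \<longleftrightarrow> y < a" "x < b \<longleftrightarrow> y < b" if "x \<in> I" "y \<in> I" for x y
      using I(1) that unfolding is_interval_1 by (meson linorder_le_less_linear order_less_imp_le)+
    have "I \<subseteq> {0..<a} \<or> I \<subseteq> {a<..<b} \<or> I \<subseteq> {b<..<1}"
    proof (cases "I = {}")
      case False
      then obtain x where x: "x \<in> I" by blast
      have "y \<in> (if x < a then {0..<a} else if x < b then {a<..<b} else {b<..<1})"
        if "y \<in> I" for y
      proof -
        have "y \<in> {0..<1}" "y \<noteq> a" "y \<noteq> b" using that I(2) \<open>a \<notin> I\<close> \<open>b \<notin> I\<close> by auto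
        then show ?thesis using sep[OF that x] by auto
      qed
      then show ?thesis by (meson subsetI)
    qed simp
    then show ?thesis
      using D1 D2 D3 by (elim disjE) (meson subsetD)+
  qed
  ultimately show ?thesis
    using bij by (simp add: AIET_def)
qed

section \<open>The two generators and their ping-pong sets\<close>

text \<open>The pieces [0,1/10), [1/10,1/5), [1/5,1) go onto [0,1/5), [2/5,1), [1/5,2/5). The cut at
  1/10 is there because the complement of [1/5,2/5) has two components; the slopes 2, 6, 1/4 are the
  ratios of lengths.\<close>

definition ping :: "real \<Rightarrow> real" where
  "ping = (\<lambda>x\<in>{0..<1}. if x < 1/10 then 2 * x else if x < 1/5 then 6 * x - 1/5 else x / 4 + 3/20)"

text \<open>Away from the breaks and the endpoint 0 this is \<open>ping\<close> conjugated by the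
  reflection x -> 1 - x; closing the pieces on the left restores right continuity.\<close>

definition pong :: "real \<Rightarrow> real" where
  "pong = (\<lambda>x\<in>{0..<1}. if x < 4/5 then x / 4 + 3/5 else if x < 9/10 then 6 * x - 24/5 else 2 * x - 1)"

lemma ping_Bij: "ping \<in> Bij {0..<1}"
proof -
  have "bij_betw ping {0..<1} {0..<1}"
    \<comment> \<open>The witness inverts \<open>ping\<close> piece by piece, cut at the inner ends
      1/5 and 2/5 of the image intervals.\<close>
    by (rule bij_betw_byWitness[where f' =
          "\<lambda>y. if y < 1/5 then y / 2 else if y < 2/5 then 4 * y - 3/5 else y / 6 + 1/30"])
      (auto simp: ping_def field_simps)
  then show ?thesis by (simp add: Bij_def ping_def)
qed

lemma pong_Bij: "pong \<in> Bij {0..<1}"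
proof -
  have "bij_betw pong {0..<1} {0..<1}"
    by (rule bij_betw_byWitness[where f' =
          "\<lambda>y. if y < 3/5 then y / 6 + 4/5 else if y < 4/5 then 4 * y - 12/5 else y / 2 + 1/2"])
      (auto simp: pong_def field_simps)
  then show ?thesis by (simp add: Bij_def pong_def)
qed

lemma ping_AIET: "ping \<in> AIET"
  by (rule three_piece_AIET[OF ping_Bij, of "1/10" "1/5" 2 0 6 "-1/5" "1/4" "3/20"])
    (auto simp: ping_def)

lemma pong_AIET: "pong \<in> AIET"
  by (rule three_piece_AIET[OF pong_Bij, of "4/5" "9/10" "1/4" "3/5" 6 "-24/5" 2 "-1"])
    (auto simp: pong_def)

theorem proposition3:
  shows "\<exists>f\<in>AIET. \<exists>g\<in>AIET.
    is_free_group_of_rank (subgroup_generated (BijGroup {0..<1}) {f, g}) 2"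
proof (intro bexI)
  define h :: "nat \<Rightarrow> real \<Rightarrow> real" where "h i = (if i = 0 then ping else pong)" for i
  define X :: "nat letter \<Rightarrow> real set" where
    "X a = (if snd a = 0 then if fst a then {1/5..<2/5} else {0..<1/5}
            else if fst a then {3/5..<4/5} else {4/5..<1})" for a
  have "subgroup_generated (BijGroup {0..<1}) (h ` {..<2}) \<cong> free_group {..<2::nat}"
  \<comment> \<open>The base point 1/2 lies in the middle fifth [2/5,3/5), which none of the sets
    \<open>X a\<close> meets.\<close>
  proof (rule ping_pong[of _ _ _ X "1/2"])
    fix i :: nat
    show "h i \<in> Bij {0..<1}" by (simp add: h_def ping_Bij pong_Bij)
    show "h i ` ({0..<1} - X (False, i)) \<subseteq> X (True, i)"
      by (auto simp: h_def X_def ping_def pong_def)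
  next
    fix a b :: "nat letter"
    assume "snd a \<in> {..<2}" "snd b \<in> {..<2}" "a \<noteq> b"
    then show "X a \<inter> X b = {}"
      by (auto simp: X_def prod_eq_iff less_2_cases_iff)
  qed (auto simp: X_def)
  moreover have "h ` {..<2::nat} = {ping, pong}"
    by (auto simp: h_def numeral_2_eq_2 lessThan_Suc)
  ultimately show "is_free_group_of_rank (subgroup_generated (BijGroup {0..<1}) {ping, pong}) 2"
    by (simp add: is_free_group_of_rank_def)
qed (fact ping_AIET pong_AIET)+

end
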